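(* Let $n\geq 4$ be an integer, and let $\mathcal{A}$ be a unital projection compressible subalgebra of $\mathbb{M}_n(\mathbb{C})$. Suppose there exist mutually orthogonal (orthogonal) projections $P_1$ and $P_2$ in $\mathbb{M}_n(\mathbb{C})$ such that $\min(\operatorname{rank}(P_1),\operatorname{rank}(P_2))\geq 2$ and $P_2\mathcal{A}P_1=\{0\}$. Then $P_1\mathcal{A}P_1=\mathbb{C}P_1$ or $P_2\mathcal{A}P_2=\mathbb{C}P_2$.
   Context: A subalgebra $\mathcal{A}$ of $\mathbb{M}_n(\mathbb{C})$ is a linear subspace closed under multiplication; it is unital if it contains the identity matrix. $\mathcal{A}$ is projection compressible if $P\mathcal{A}P=\{PAP:A\in\mathcal{A}\}$ is an algebra (i.e. closed under multiplication) for every orthogonal projection $P=P^2=P^*\in\mathbb{M}_n(\mathbb{C})$. For matrices $X,Y$, $X\mathcal{A}Y=\{XAY:A\in\mathcal{A}\}$. *)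

theory Defs
  imports "HOL-Analysis.Analysis"
begin

(* The library's *s is only the scalar action on vectors, and *\<^sub>R only the real one;
   M_n(C) needs the complex scalar action on matrices. *)
definition cscale :: "complex \<Rightarrow> complex^'n^'m \<Rightarrow> complex^'n^'m" where
  "cscale c A = (\<chi> i j. c * A $ i $ j)"

interpretation cmat: vector_space "cscale :: complex \<Rightarrow> complex^'n^'m \<Rightarrow> complex^'n^'m"
  by unfold_locales (simp_all add: cscale_def vec_eq_iff algebra_simps)

definition adjoint_mat :: "complex^'n^'m \<Rightarrow> complex^'m^'n" where
  "adjoint_mat A = (\<chi> i j. cnj (A $ j $ i))"

definition is_projection :: "complex^'n^'n \<Rightarrow> bool" where
  "is_projection P \<longleftrightarrow> P ** P = P \<and> adjoint_mat P = P"

definition sandwich :: "complex^'n^'n \<Rightarrow> (complex^'n^'n) set \<Rightarrow> complex^'n^'n \<Rightarrow> (complex^'n^'n) set" where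
  "sandwich X \<A> Y = {X ** A ** Y | A. A \<in> \<A>}"

(* A unit is not required: for unital \<A> and P \<noteq> 1, the corner P \<A> P has unit P but lacks the identity. *)
definition is_subalgebra :: "(complex^'n^'n) set \<Rightarrow> bool" where
  "is_subalgebra \<A> \<longleftrightarrow> cmat.subspace \<A> \<and> (\<forall>A\<in>\<A>. \<forall>B\<in>\<A>. A ** B \<in> \<A>)"

definition unital :: "(complex^'n^'n) set \<Rightarrow> bool" where
  "unital \<A> \<longleftrightarrow> mat 1 \<in> \<A>"

definition projection_compressible :: "(complex^'n^'n) set \<Rightarrow> bool" where
  "projection_compressible \<A> \<longleftrightarrow> (\<forall>P. is_projection P \<longrightarrow> is_subalgebra (sandwich P \<A> P))"

end

(* If both corners were nonscalar, one could choose orthogonal e1, e2 in ran P1 and f1, f2 in ran P2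
   with <A e1, e2> and <B f1, f2> nonzero for some A, B in the algebra.  Let P be the projection
   onto the span of the orthogonal vectors e1, e2 + f1, f2.  Every compression P C P satisfies
   <P C P e1, f2> = <C e1, f2> = 0, whereas the product of the compressions of B and A maps e1,
   through e2 + f1, to a vector with nonzero component along f2. *)
theory Submission
  imports Defs
begin

definition cinner :: "complex^'n \<Rightarrow> complex^'n \<Rightarrow> complex" where
  "cinner x y = (\<Sum>i\<in>UNIV. x $ i * cnj (y $ i))"

lemma cinner_simps [simp]:
  "cinner (x + y) z = cinner x z + cinner y z"
  "cinner z (x + y) = cinner z x + cinner z y"
  "cinner (x - y) z = cinner x z - cinner y z"
  "cinner z (x - y) = cinner z x - cinner z y"
  "cinner (c *s x) z = c * cinner x z"
  "cinner z (c *s x) = cnj c * cinner z x"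
  "cinner 0 z = 0"
  "cinner z 0 = 0"
  by (simp_all add: cinner_def algebra_simps sum.distrib sum_subtractf sum_distrib_left)

lemma cinner_commute: "cinner y x = cnj (cinner x y)"
  by (simp add: cinner_def mult.commute)

lemma cinner_self: "cinner x x = of_real (\<Sum>i\<in>UNIV. (cmod (x $ i))\<^sup>2)"
  by (simp add: cinner_def complex_norm_square [symmetric])

lemma cinner_eq_zero_iff [simp]: "cinner x x = 0 \<longleftrightarrow> x = 0"
  unfolding cinner_self of_real_eq_0_iff
  by (subst sum_nonneg_eq_0_iff) (auto simp: vec_eq_iff)

lemma cinner_adjoint: "cinner (A *v x) y = cinner x (adjoint_mat A *v y)"
proof -
  have "cinner (A *v x) y = (\<Sum>i\<in>UNIV. \<Sum>j\<in>UNIV. A $ i $ j * x $ j * cnj (y $ i))"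
    by (simp add: cinner_def matrix_vector_mult_def sum_distrib_right)
  also have "\<dots> = (\<Sum>j\<in>UNIV. \<Sum>i\<in>UNIV. A $ i $ j * x $ j * cnj (y $ i))"
    by (rule sum.swap)
  also have "\<dots> = cinner x (adjoint_mat A *v y)"
    by (simp add: cinner_def matrix_vector_mult_def adjoint_mat_def sum_distrib_left mult_ac)
  finally show ?thesis .
qed

lemma cinner_projection: "is_projection P \<Longrightarrow> cinner (P *v x) y = cinner x (P *v y)"
  by (simp add: cinner_adjoint is_projection_def)

lemma cscale_vec [simp]: "cscale c A *v x = c *s (A *v x)"
  by (simp add: cscale_def matrix_vector_mult_def vec_eq_iff sum_distrib_left mult_ac)

lemma projection_idem: "is_projection P \<Longrightarrow> P *v (P *v x) = P *v x"
  by (simp add: matrix_vector_mul_assoc is_projection_def)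

text \<open>The orthogonal projection onto the line through \<open>u\<close>. At
  \<open>u = 0\<close> division by zero makes it the zero matrix, which is still a
  projection.\<close>

definition line_proj :: "complex^'n \<Rightarrow> complex^'n^'n" where
  "line_proj u = (\<chi> i j. u $ i * cnj (u $ j) / cinner u u)"

lemma line_proj_vec: "line_proj u *v x = (cinner x u / cinner u u) *s u"
  by (simp add: line_proj_def matrix_vector_mult_def vec_eq_iff cinner_def
      sum_distrib_left sum_distrib_right sum_divide_distrib mult_ac)

lemma adjoint_line_proj: "adjoint_mat (line_proj u) = line_proj u"
proof -
  have "cnj (cinner u u) = cinner u u"
    by (metis cinner_commute)
  then show ?thesis
    by (simp add: adjoint_mat_def line_proj_def vec_eq_iff mult.commute)
qed

text \<open>Orthogonality kills the cross terms in the square, leaving the three idempotent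
  summands, each self-adjoint. Zero vectors are harmless, as their summand vanishes.\<close>

lemma is_projection_line_proj_sum:
  assumes "cinner u v = 0" "cinner u w = 0" "cinner v w = 0"
  shows "is_projection (line_proj u + line_proj v + line_proj w)" (is "is_projection ?P")
proof -
  have sym: "cinner v u = 0" "cinner w u = 0" "cinner w v = 0"
    using assms by (simp_all add: cinner_commute [of v u] cinner_commute [of w u] cinner_commute [of w v])
  have "?P ** ?P = ?P"
    unfolding matrix_eq
    using assms sym
    by (auto simp: matrix_vector_mul_assoc [symmetric] matrix_vector_mult_add_rdistrib line_proj_vec)
  moreover have "adjoint_mat ?P = ?P"
  proof -
    have "adjoint_mat ?P = adjoint_mat (line_proj u) + adjoint_mat (line_proj v) + adjoint_mat (line_proj w)"
      by (simp add: adjoint_mat_def vec_eq_iff)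
    then show ?thesis
      by (simp add: adjoint_line_proj)
  qed
  ultimately show ?thesis
    by (simp add: is_projection_def)
qed

text \<open>Reduces the two corners to single entries: a nonzero entry from \<open>e1\<close> to
  \<open>e2\<close> somewhere in the algebra forces every entry from \<open>f1\<close> to
  \<open>f2\<close> to vanish. Nothing is assumed about entries from \<open>e2\<close> to
  \<open>f1\<close>.\<close>

lemma compressible_corner_product:
  fixes \<A> :: "(complex^'n^'n) set"
  assumes compr: "projection_compressible \<A>"
    and orth: "cinner e1 e2 = 0" "cinner e1 f1 = 0" "cinner e1 f2 = 0" "cinner e2 f2 = 0" "cinner f1 f2 = 0"
      "cinner e2 f1 = 0"
    and corner: "\<And>C. C \<in> \<A> \<Longrightarrow> cinner (C *v e1) f1 = 0"
      "\<And>C. C \<in> \<A> \<Longrightarrow> cinner (C *v e1) f2 = 0"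
      "\<And>C. C \<in> \<A> \<Longrightarrow> cinner (C *v e2) f2 = 0"
    and A: "A \<in> \<A>" "cinner (A *v e1) e2 \<noteq> 0"
    and B: "B \<in> \<A>"
  shows "cinner (B *v f1) f2 = 0"
proof (cases "f2 = 0")
  case True
  then show ?thesis by simp
next
  case f2: False
  \<comment> \<open>The vector \<open>g\<close> links the two corners: \<open>A\<close> reaches it
    from \<open>e1\<close> through the summand \<open>e2\<close>, and \<open>B\<close> leaves it
    towards \<open>f2\<close> through the summand \<open>f1\<close>.\<close>
  define g where "g = e2 + f1"
  define P where "P = line_proj e1 + line_proj g + line_proj f2"
  have e1: "e1 \<noteq> 0" and e2: "e2 \<noteq> 0"
    using A(2) by auto
  have "cinner f1 e2 = 0"
    using orth(6) by (simp add: cinner_commute [of f1 e2])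
  then have "cinner e2 g = cinner e2 e2"
    using orth by (simp add: g_def)
  then have g: "g \<noteq> 0"
    using e2 by auto
  have e1g: "cinner e1 g = 0" and gf2: "cinner g f2 = 0"
    using orth by (simp_all add: g_def)
  have sym: "cinner f2 e1 = 0" "cinner f2 g = 0"
    using orth gf2 by (simp_all add: cinner_commute [of f2 e1] cinner_commute [of f2 g])
  have P: "is_projection P"
    unfolding P_def using e1g orth(3) gf2 by (rule is_projection_line_proj_sum)
  have Pv: "P *v x = (cinner x e1 / cinner e1 e1) *s e1 + (cinner x g / cinner g g) *s g
      + (cinner x f2 / cinner f2 f2) *s f2" for x
    by (simp add: P_def matrix_vector_mult_add_rdistrib line_proj_vec)
  have Pe1: "P *v e1 = e1" and Pf2: "P *v f2 = f2"
    using e1 f2 e1g orth(3) sym by (simp_all add: Pv)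
  have "is_subalgebra (sandwich P \<A> P)"
    using compr P by (simp add: projection_compressible_def)
  moreover have "P ** B ** P \<in> sandwich P \<A> P" "P ** A ** P \<in> sandwich P \<A> P"
    using A(1) B by (auto simp: sandwich_def)
  ultimately have "(P ** B ** P) ** (P ** A ** P) \<in> sandwich P \<A> P"
    by (simp add: is_subalgebra_def)
  then obtain C where C: "C \<in> \<A>" and eq: "(P ** B ** P) ** (P ** A ** P) = P ** C ** P"
    by (auto simp: sandwich_def)
  have "((P ** B ** P) ** (P ** A ** P)) *v e1 = (P ** C ** P) *v e1"
    by (simp add: eq)
  then have "P *v (B *v (P *v (A *v e1))) = P *v (C *v e1)"
    by (simp add: matrix_vector_mul_assoc [symmetric] Pe1 projection_idem [OF P])
  then have "cinner (P *v (B *v (P *v (A *v e1)))) f2 = cinner (P *v (C *v e1)) f2"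
    by simp
  then have "cinner (B *v (P *v (A *v e1))) f2 = 0"
    using corner(2) [OF C] by (simp add: cinner_projection [OF P] Pf2)
  \<comment> \<open>Since \<open>A *v e1\<close> is orthogonal to \<open>f1\<close> and
    \<open>f2\<close>, its product with \<open>g\<close> sees only \<open>e2\<close>, and the
    \<open>f2\<close> term of \<open>P\<close> disappears.\<close>
  moreover have "P *v (A *v e1) = (cinner (A *v e1) e1 / cinner e1 e1) *s e1
      + (cinner (A *v e1) e2 / cinner g g) *s g"
    using corner [OF A(1)] by (simp add: Pv g_def)
  \<comment> \<open>The \<open>e1\<close> term contributes nothing, because \<open>B *v e1\<close>
    is orthogonal to \<open>f2\<close>.\<close>
  ultimately have "cinner (A *v e1) e2 / cinner g g * cinner (B *v g) f2 = 0"
    using corner(2) [OF B] by (simp add: matrix_vector_right_distrib vector_scalar_commute)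
  then have "cinner (B *v g) f2 = 0"
    using A(2) g by simp
  then show ?thesis
    using corner(3) [OF B] by (simp add: g_def matrix_vector_right_distrib)
qed

text \<open>The hypothesis makes every vector of the range of \<open>P\<close> an eigenvector of the
  compression of \<open>M\<close>, and an operator with this property is scalar.\<close>

lemma scalar_corner:
  fixes P M :: "complex^'n^'n"
  assumes P: "is_projection P"
    and orth: "\<And>x y. P *v x = x \<Longrightarrow> P *v y = y \<Longrightarrow> cinner x y = 0 \<Longrightarrow> cinner (M *v x) y = 0"
  obtains c where "P ** M ** P = cscale c P"
proof -
  have eigen: "\<exists>c. P *v (M *v x) = c *s x" if x: "P *v x = x" for x
  proof (cases "x = 0")
    case False
    define z where "z = P *v (M *v x)"
    define y where "y = z - (cinner z x / cinner x x) *s x"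
    have y: "P *v y = y"
      by (simp add: y_def z_def x projection_idem [OF P] matrix_vector_mult_diff_distrib vector_scalar_commute)
    have yx: "cinner y x = 0"
      using False by (simp add: y_def)
    then have xy: "cinner x y = 0"
      by (simp add: cinner_commute [of x y])
    \<comment> \<open>Both \<open>z\<close> (by hypothesis) and \<open>x\<close> (by construction)
      are orthogonal to \<open>y\<close>, which is a combination of them; hence \<open>y\<close> is
      orthogonal to itself.\<close>
    have "cinner z y = 0"
      using orth [OF x y xy] by (simp add: z_def cinner_projection [OF P] y)
    moreover have "cinner y y = cinner z y - cinner z x / cinner x x * cinner x y"
      by (subst (1) y_def) (simp only: cinner_simps)
    ultimately have "y = 0"
      using xy by simp
    then have "z = (cinner z x / cinner x x) *s x"
      by (simp add: y_def)
    then show ?thesis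
      unfolding z_def by blast
  qed simp
  \<comment> \<open>So far the eigenvalue may depend on the vector. It is compared with that of one
    fixed nonzero \<open>x\<close> by evaluating at \<open>x + y\<close>.\<close>
  have "\<exists>c. \<forall>x. P *v x = x \<longrightarrow> P *v (M *v x) = c *s x"
  proof (cases "\<exists>x. P *v x = x \<and> x \<noteq> 0")
    case True
    then obtain x where x: "P *v x = x" "x \<noteq> 0" by blast
    obtain c where c: "P *v (M *v x) = c *s x"
      using eigen x by blast
    have "P *v (M *v y) = c *s y" if y: "P *v y = y" for y
    proof -
      obtain d where d: "P *v (M *v y) = d *s y"
        using eigen y by blast
      have "P *v (x + y) = x + y"
        by (simp add: matrix_vector_right_distrib x y)
      then obtain b where "P *v (M *v (x + y)) = b *s (x + y)"
        using eigen by blast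
      then have *: "c *s x + d *s y = b *s x + b *s y"
        by (simp add: matrix_vector_right_distrib c d vec.scale_right_distrib)
      then have comb: "(b - c) *s x = (d - b) *s y"
        by (simp add: vec.scale_left_diff_distrib algebra_simps)
      \<comment> \<open>If \<open>b = c\<close>, cancelling in \<open>*\<close> gives the claim.
        Otherwise \<open>comb\<close> makes \<open>x\<close> a multiple of \<open>y\<close>, so both
        share the eigenvalue \<open>c\<close>.\<close>
      show ?thesis
      proof (cases "b = c")
        case True
        then show ?thesis using * d by simp
      next
        case False
        then have "x = ((d - b) / (b - c)) *s y"
          using arg_cong [OF comb, of "\<lambda>v. (1 / (b - c)) *s v"]
          by (simp add: vec.scale_scale del: vector_sub_rdistrib)
        then obtain t where t: "x = t *s y" by blast
        then have "t \<noteq> 0" using x(2) by auto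
        moreover have "t *s (P *v (M *v y)) = t *s (c *s y)"
          using c by (simp add: t vector_scalar_commute mult.commute)
        ultimately show ?thesis
          by (simp only: vec.scale_cancel_left) auto
      qed
    qed
    then show ?thesis by blast
  next
    case False
    \<comment> \<open>The range of \<open>P\<close> is zero here, so any \<open>c\<close>
      serves.\<close>
    then show ?thesis by (metis matrix_vector_mult_0_right vec.scale_zero_right)
  qed
  then obtain c where c: "\<And>x. P *v x = x \<Longrightarrow> P *v (M *v x) = c *s x" by blast
  have "P ** M ** P = cscale c P"
    unfolding matrix_eq
    by (simp add: matrix_vector_mul_assoc [symmetric] c projection_idem [OF P])
  then show ?thesis by (rule that)
qed

text \<open>Unitality places all multiples of \<open>P\<close> in the corner, so a corner other than
  these contains a nonscalar compression; the vectors then come from the contrapositive of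
  \<open>scalar_corner\<close>.\<close>

lemma nonscalar_corner:
  fixes \<A> :: "(complex^'n^'n) set"
  assumes "is_subalgebra \<A>" "unital \<A>" and P: "is_projection P"
    and ne: "sandwich P \<A> P \<noteq> {cscale c P | c. True}"
  obtains A x y where "A \<in> \<A>" "P *v x = x" "P *v y = y" "cinner x y = 0" "cinner (A *v x) y \<noteq> 0"
proof -
  have "{cscale c P | c. True} \<subseteq> sandwich P \<A> P"
  proof clarify
    fix c
    have "cscale c (mat 1) \<in> \<A>"
      using assms(1,2) by (simp add: is_subalgebra_def unital_def cmat.subspace_scale)
    moreover have "cscale c P = P ** cscale c (mat 1) ** P"
      unfolding matrix_eq
      by (simp add: matrix_vector_mul_assoc [symmetric] vector_scalar_commute projection_idem [OF P])
    ultimately show "cscale c P \<in> sandwich P \<A> P"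
      by (auto simp: sandwich_def)
  qed
  then obtain A where A: "A \<in> \<A>" "\<nexists>c. P ** A ** P = cscale c P"
    using ne by (auto simp: sandwich_def)
  have "\<exists>x y. P *v x = x \<and> P *v y = y \<and> cinner x y = 0 \<and> cinner (A *v x) y \<noteq> 0"
    using A(2) scalar_corner [OF P, of A] by metis
  then show ?thesis
    using A(1) that by blast
qed

theorem theorem3p0p1:
  fixes \<A> :: "(complex^'n^'n) set" and P\<^sub>1 P\<^sub>2 :: "complex^'n^'n"
  assumes "CARD('n) \<ge> 4"
    and "is_subalgebra \<A>" and "unital \<A>" and "projection_compressible \<A>"
    and "is_projection P\<^sub>1" and "is_projection P\<^sub>2"
    and "P\<^sub>1 ** P\<^sub>2 = 0"
    and "min (rank P\<^sub>1) (rank P\<^sub>2) \<ge> 2"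
    and "sandwich P\<^sub>2 \<A> P\<^sub>1 = {0}"
  shows "sandwich P\<^sub>1 \<A> P\<^sub>1 = {cscale c P\<^sub>1 | c. True}
    \<or> sandwich P\<^sub>2 \<A> P\<^sub>2 = {cscale c P\<^sub>2 | c. True}"
proof (rule ccontr)
  assume "\<not> ?thesis"
  then have ne1: "sandwich P\<^sub>1 \<A> P\<^sub>1 \<noteq> {cscale c P\<^sub>1 | c. True}"
    and ne2: "sandwich P\<^sub>2 \<A> P\<^sub>2 \<noteq> {cscale c P\<^sub>2 | c. True}"
    by blast+
  note P1 = assms(5) and P2 = assms(6)
  obtain A e1 e2 where A: "A \<in> \<A>" "P\<^sub>1 *v e1 = e1" "P\<^sub>1 *v e2 = e2" "cinner e1 e2 = 0" "cinner (A *v e1) e2 \<noteq> 0"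
    using nonscalar_corner [OF assms(2,3) P1 ne1] by metis
  obtain B f1 f2 where B: "B \<in> \<A>" "P\<^sub>2 *v f1 = f1" "P\<^sub>2 *v f2 = f2" "cinner f1 f2 = 0" "cinner (B *v f1) f2 \<noteq> 0"
    using nonscalar_corner [OF assms(2,3) P2 ne2] by metis
  \<comment> \<open>The product \<open>P\<^sub>1 ** P\<^sub>2 = 0\<close> makes the two ranges
    orthogonal.\<close>
  have orth: "cinner e f = 0" if "P\<^sub>1 *v e = e" "P\<^sub>2 *v f = f" for e f
  proof -
    have "cinner e f = cinner e (P\<^sub>1 *v (P\<^sub>2 *v f))"
      using that cinner_projection [OF P1, of e f] by simp
    then show ?thesis
      by (simp add: matrix_vector_mul_assoc assms(7))
  qed
  \<comment> \<open>The vanishing corner, read as entries from the range of \<open>P\<^sub>1\<close>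
    to that of \<open>P\<^sub>2\<close>; it supplies all three corner conditions at once.\<close>
  have corner: "cinner (C *v e) f = 0" if "C \<in> \<A>" "P\<^sub>1 *v e = e" "P\<^sub>2 *v f = f" for C e f
  proof -
    have "P\<^sub>2 ** C ** P\<^sub>1 = 0"
      using that(1) assms(9) by (auto simp: sandwich_def)
    then have "P\<^sub>2 *v (C *v (P\<^sub>1 *v e)) = 0"
      by (simp add: matrix_vector_mul_assoc matrix_mul_assoc)
    then show ?thesis
      using that cinner_projection [OF P2, of "C *v e" f] by simp
  qed
  have "cinner (B *v f1) f2 = 0"
    by (rule compressible_corner_product [OF assms(4), of e1 e2 f1 f2 A B])
      (use A B orth corner in auto)
  with B(5) show False by simp
qed

end
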